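(* Let $G$ be an infinite discrete group and let $(X,G)$ be an IP$^*$-central system. Then $(X,G)$ is distal if and only if it is pairwise IP$^*$-equicontinuous.
   Context: A system $(X,G)$ consists of a (nonempty) compact metric space $X$ with compatible metric $d$ and an infinite discrete group $G$ acting continuously on $X$. $(X,G)$ is distal if $\inf_{g\in G}d(gx,gy)>0$ for any two distinct $x,y\in X$. For a sequence $\{p_i\}_{i=1}^\infty$ in $G$, $FP(\{p_i\}_{i=1}^\infty)=\{\prod_{i\in\alpha}p_i : \alpha\subset\mathbb{N}\text{ finite nonempty}\}$, products taken in increasing order of indices. $F\subset G$ is an IP-set if $FP(\{p_i\}_{i=1}^\infty)\subset F$ for some infinite sequence $\{p_i\}_{i=1}^\infty$ in $G$; an IP$^*$-set if it meets every IP-set in $G$. $(X,G)$ is IP$^*$-central if for every nonempty open $U\subset X$ the set $N(U,U)=\{g\in G: gU\cap U\ne\emptyset\}$ is an IP$^*$-set. A point $x\in X$ is pairwise IP$^*$-equicontinuous if for every $\varepsilon>0$ there is a neighborhood $U$ of $x$ such that for all $y,z\in U$ the set $\{g\in G: d(gy,gz)<\varepsilon\}$ is an IP$^*$-set. $(X,G)$ is pairwise IP$^*$-equicontinuous if every point of $X$ is. *)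

theory Defs
  imports "HOL-Analysis.Analysis" "HOL-Algebra.Group_Action"
begin

text \<open>Since G is discrete, continuity of the action is continuity of each single map
  \<open>\<phi> g\<close>. The maps \<open>\<phi> g\<close> are extensional on X, as \<open>group_action\<close> requires.\<close>

locale dynamical_system =
  Metric_space X d + group_action G X \<phi>
  for X :: "'x set" and d :: "'x \<Rightarrow> 'x \<Rightarrow> real"
    and G :: "('g, 'm) monoid_scheme" (structure) and \<phi> :: "'g \<Rightarrow> 'x \<Rightarrow> 'x" +
  assumes nonempty: "X \<noteq> {}"
    and compact: "compact_space mtopology"
    and infinite_group: "infinite (carrier G)"
    and continuous_action:
      "g \<in> carrier G \<Longrightarrow> continuous_map mtopology mtopology (\<phi> g)"

text \<open>Finite products \<open>p i\<^sub>1 \<otimes> \<dots> \<otimes> p i\<^sub>k\<close> over \<open>i\<^sub>1 < \<dots> < i\<^sub>k\<close>. Sequences are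
  indexed from 0, and their terms need not be distinct.\<close>

definition FP :: "('g, 'm) monoid_scheme \<Rightarrow> (nat \<Rightarrow> 'g) \<Rightarrow> 'g set"
  where "FP G p =
    {foldr (mult G) (map p (sorted_list_of_set \<alpha>)) \<one>\<^bsub>G\<^esub> | \<alpha>. finite \<alpha> \<and> \<alpha> \<noteq> {}}"

definition IP_set :: "('g, 'm) monoid_scheme \<Rightarrow> 'g set \<Rightarrow> bool"
  where "IP_set G F \<longleftrightarrow>
    F \<subseteq> carrier G \<and> (\<exists>p. (\<forall>i. p i \<in> carrier G) \<and> FP G p \<subseteq> F)"

definition IP_star_set :: "('g, 'm) monoid_scheme \<Rightarrow> 'g set \<Rightarrow> bool"
  where "IP_star_set G F \<longleftrightarrow>
    F \<subseteq> carrier G \<and> (\<forall>E. IP_set G E \<longrightarrow> F \<inter> E \<noteq> {})"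

context dynamical_system
begin

definition distal :: bool
  where "distal \<longleftrightarrow>
    (\<forall>x\<in>X. \<forall>y\<in>X. x \<noteq> y \<longrightarrow> (INF g\<in>carrier G. d (\<phi> g x) (\<phi> g y)) > 0)"

definition return_set :: "'x set \<Rightarrow> 'x set \<Rightarrow> 'g set"
  where "return_set U V = {g \<in> carrier G. \<phi> g ` U \<inter> V \<noteq> {}}"

definition IP_star_central :: bool
  where "IP_star_central \<longleftrightarrow>
    (\<forall>U. openin mtopology U \<and> U \<noteq> {} \<longrightarrow> IP_star_set G (return_set U U))"

definition pairwise_IP_star_equicontinuous_at :: "'x \<Rightarrow> bool"
  where "pairwise_IP_star_equicontinuous_at x \<longleftrightarrow>
    (\<forall>\<epsilon>>0. \<exists>U. openin mtopology U \<and> x \<in> U \<and>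
      (\<forall>y\<in>U. \<forall>z\<in>U. IP_star_set G {g \<in> carrier G. d (\<phi> g y) (\<phi> g z) < \<epsilon>}))"

definition pairwise_IP_star_equicontinuous :: bool
  where "pairwise_IP_star_equicontinuous \<longleftrightarrow>
    (\<forall>x\<in>X. pairwise_IP_star_equicontinuous_at x)"

end

end

(* If the system is central and pairwise equicontinuous, an IP-set can be refined so that one
   point w close to x returns close to x along all of it; equicontinuity then compares x with w,
   so every point x is IP-star-recurrent.  For a proximal pair x, y, uniform continuity of finitely
   many maps at a time yields an IP-set along which g x and g y stay close; refining it so
   that x returns near x, and then returning y near y, forces x = y.

   Conversely, the limit maps of an IP-system form a compact semigroup, which contains an
   idempotent u.  Since x and u x are proximal, distality forces u to be the identity, so any two
   points return simultaneously along every IP-set. *)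

theory Submission
  imports Defs
begin

text \<open>The notation would clash with the topological closure.\<close>

no_notation eq_closure_of (\<open>closure'_of\<index>\<close>)

lemma closure_of_meets_open:
  "x \<in> T closure_of A \<Longrightarrow> openin T U \<Longrightarrow> x \<in> U \<Longrightarrow> \<exists>a\<in>A. a \<in> U"
  unfolding in_closure_of by blast

section \<open>Idempotents in compact semigroups\<close>

text \<open>Only right translations are assumed continuous.  A minimal closed subsemigroup \<open>A\<close>
  satisfies \<open>A u = A\<close> and \<open>{v \<in> A. v u = u} = A\<close> for each of its elements \<open>u\<close>.\<close>

lemma Ellis_Numakura:
  fixes m :: "'a \<Rightarrow> 'a \<Rightarrow> 'a"
  assumes compact: "compact_space T" and haus: "Hausdorff_space T" and ne: "topspace T \<noteq> {}"
    and closed: "\<And>f g. f \<in> topspace T \<Longrightarrow> g \<in> topspace T \<Longrightarrow> m f g \<in> topspace T"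
    and assoc: "\<And>f g h. f \<in> topspace T \<Longrightarrow> g \<in> topspace T \<Longrightarrow> h \<in> topspace T \<Longrightarrow>
      m (m f g) h = m f (m g h)"
    and cont: "\<And>g. g \<in> topspace T \<Longrightarrow> continuous_map T T (\<lambda>f. m f g)"
  shows "\<exists>u\<in>topspace T. m u u = u"
proof -
  define \<A> where "\<A> = {A. closedin T A \<and> A \<noteq> {} \<and> (\<forall>f\<in>A. \<forall>g\<in>A. m f g \<in> A)}"
  \<comment> \<open>Zorn's lemma for reverse inclusion. A nonempty chain is bounded by its
    intersection, which is nonempty by compactness: a finite subfamily of a chain has a least
    member.\<close>
  have "\<exists>A\<in>\<A>. \<forall>B\<in>\<A>. B \<subseteq> A \<longrightarrow> B = A"
  proof (rule predicate_Zorn)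
    show "partial_order_on \<A> (relation_of (\<lambda>A B. B \<subseteq> A) \<A>)"
      by (rule partial_order_on_relation_ofI) auto
    fix C assume C: "C \<in> Chains (relation_of (\<lambda>A B. B \<subseteq> A) \<A>)"
    then have CA: "C \<subseteq> \<A>" and lin: "\<And>A B. A \<in> C \<Longrightarrow> B \<in> C \<Longrightarrow> A \<subseteq> B \<or> B \<subseteq> A"
      unfolding Chains_def relation_of_def by blast+
    show "\<exists>U\<in>\<A>. \<forall>A\<in>C. U \<subseteq> A"
    proof (cases "C = {}")
      case True
      have "topspace T \<in> \<A>"
        unfolding \<A>_def using ne closed by auto
      with True show ?thesis by blast
    next
      case False
      have "\<Inter>C \<noteq> {}"
      proof -
        have "\<Inter>\<F> \<noteq> {}" if "finite \<F>" "\<F> \<subseteq> C" for \<F>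
        proof (cases "\<F> = {}")
          case nonempty: False
          have "\<exists>A\<in>\<F>. \<forall>B\<in>\<F>. A \<subseteq> B"
            using that(1) nonempty that(2)
          proof (induction rule: finite_ne_induct)
            case (insert A F)
            then obtain B where B: "B \<in> F" "\<forall>D\<in>F. B \<subseteq> D" by auto
            then consider "A \<subseteq> B" | "B \<subseteq> A"
              using lin insert.prems by blast
            then show ?case
            proof cases
              case 1
              then show ?thesis using B by (intro bexI[of _ A]) auto
            next
              case 2
              then show ?thesis using B by (intro bexI[of _ B]) auto
            qed
          qed auto
          then obtain A where "A \<in> \<F>" "A \<subseteq> \<Inter>\<F>" by blast
          moreover have "A \<noteq> {}"
            using \<open>A \<in> \<F>\<close> that(2) CA unfolding \<A>_def by auto
          ultimately show ?thesis by auto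
        qed auto
        moreover have "\<forall>A\<in>C. closedin T A"
          using CA unfolding \<A>_def by auto
        ultimately show ?thesis
          using compact[unfolded compact_space_fip, THEN spec, of C] by simp
      qed
      moreover have "closedin T (\<Inter>C)"
        using CA False unfolding \<A>_def by (intro closedin_Inter) auto
      moreover have "m f g \<in> \<Inter>C" if "f \<in> \<Inter>C" "g \<in> \<Inter>C" for f g
        using that CA unfolding \<A>_def by blast
      ultimately have "\<Inter>C \<in> \<A>"
        unfolding \<A>_def by simp
      then show ?thesis by blast
    qed
  qed
  then obtain A where A: "A \<in> \<A>" and min: "\<And>B. B \<in> \<A> \<Longrightarrow> B \<subseteq> A \<Longrightarrow> B = A"
    by auto
  then have cl: "closedin T A" and sub: "A \<subseteq> topspace T"
    and mult: "\<And>f g. f \<in> A \<Longrightarrow> g \<in> A \<Longrightarrow> m f g \<in> A"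
    using closedin_subset[of T A] unfolding \<A>_def by auto
  obtain u where u: "u \<in> A"
    using A unfolding \<A>_def by auto
  have uT: "u \<in> topspace T"
    using u sub by auto
  have "(\<lambda>f. m f u) ` A = A"
  proof (rule min)
    have "compactin T ((\<lambda>f. m f u) ` A)"
      using image_compactin closedin_compact_space[OF compact cl] cont[OF uT] by blast
    then have "closedin T ((\<lambda>f. m f u) ` A)"
      using haus compactin_imp_closedin by blast
    moreover have "m (m f u) (m g u) \<in> (\<lambda>f. m f u) ` A" if "f \<in> A" "g \<in> A" for f g
    proof -
      have "m (m f u) (m g u) = m (m (m f u) g) u"
        using assoc[of "m f u" g u] that u mult sub by (metis subsetD)
      then show ?thesis
        using that u mult by auto
    qed
    ultimately show "(\<lambda>f. m f u) ` A \<in> \<A>"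
      unfolding \<A>_def using u by auto
  qed (use mult u in auto)
  then have "u \<in> (\<lambda>f. m f u) ` A"
    using u by simp
  then obtain v where v: "v \<in> A" "m v u = u"
    by auto
  have "{f \<in> A. m f u = u} = A"
  proof (rule min)
    have "closedin T {f \<in> A. m f u \<in> {u}}"
      using closedin_continuous_map_preimage_gen[OF cont[OF uT] cl]
        closedin_Hausdorff_singleton[OF haus uT] by blast
    moreover have "m (m f g) u = u" if "f \<in> A" "g \<in> A" "m f u = u" "m g u = u" for f g
      using that assoc sub u by (metis subsetD)
    ultimately show "{f \<in> A. m f u = u} \<in> \<A>"
      unfolding \<A>_def using v mult by auto
  qed auto
  \<comment> \<open>As \<open>u\<close> lies in \<open>A\<close>, it is in its own stabiliser, that
    is, \<open>m u u = u\<close>.\<close>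
  then show ?thesis
    using u uT by auto
qed

section \<open>Finite products along a sequence\<close>

text \<open>Unlike \<open>FP\<close>, this keeps the index set visible, so that products over
  consecutive index sets can be merged.\<close>

definition IP_prod :: "('g, 'm) monoid_scheme \<Rightarrow> (nat \<Rightarrow> 'g) \<Rightarrow> nat set \<Rightarrow> 'g"
  where "IP_prod G p \<alpha> = foldr (mult G) (map p (sorted_list_of_set \<alpha>)) \<one>\<^bsub>G\<^esub>"

lemma FP_eq: "FP G p = {IP_prod G p \<alpha> | \<alpha>. finite \<alpha> \<and> \<alpha> \<noteq> {}}"
  unfolding FP_def IP_prod_def ..

lemma IP_prod_empty [simp]: "IP_prod G p {} = \<one>\<^bsub>G\<^esub>"
  unfolding IP_prod_def by simp

lemma sorted_list_of_set_Un:
  fixes \<alpha> \<beta> :: "'a::linorder set"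
  assumes "finite \<alpha>" "finite \<beta>" "\<And>a b. a \<in> \<alpha> \<Longrightarrow> b \<in> \<beta> \<Longrightarrow> a < b"
  shows "sorted_list_of_set (\<alpha> \<union> \<beta>) = sorted_list_of_set \<alpha> @ sorted_list_of_set \<beta>"
  by (rule sorted_distinct_set_unique) (use assms in \<open>fastforce simp: sorted_append\<close>)+

lemma less_above_Max:
  fixes \<alpha> \<beta> :: "nat set"
  assumes "finite \<alpha>" "\<beta> \<subseteq> {Suc (Max \<alpha>)..}" "a \<in> \<alpha>" "b \<in> \<beta>"
  shows "a < b"
proof -
  have "a \<le> Max \<alpha>" "Suc (Max \<alpha>) \<le> b"
    using assms by auto
  then show ?thesis by linarith
qed

lemma IP_star_set_mono:
  "IP_star_set G A \<Longrightarrow> A \<subseteq> B \<Longrightarrow> B \<subseteq> carrier G \<Longrightarrow> IP_star_set G B"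
  unfolding IP_star_set_def by fast

context monoid
begin

lemma foldr_mult_closed:
  "set xs \<subseteq> carrier G \<Longrightarrow> foldr (\<otimes>) xs \<one> \<in> carrier G"
  by (induction xs) auto

lemma foldr_mult_append:
  "set xs \<subseteq> carrier G \<Longrightarrow> set ys \<subseteq> carrier G \<Longrightarrow>
    foldr (\<otimes>) (xs @ ys) \<one> = foldr (\<otimes>) xs \<one> \<otimes> foldr (\<otimes>) ys \<one>"
  by (induction xs) (auto simp: foldr_mult_closed m_assoc simp del: foldr_append)

lemma IP_prod_closed:
  assumes "\<And>i. p i \<in> carrier G"
  shows "IP_prod G p \<alpha> \<in> carrier G"
  unfolding IP_prod_def using assms by (intro foldr_mult_closed) auto

lemma FP_subset_carrier: "(\<And>i. p i \<in> carrier G) \<Longrightarrow> FP G p \<subseteq> carrier G"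
  unfolding FP_eq using IP_prod_closed by blast

lemma IP_set_FP: "(\<And>i. p i \<in> carrier G) \<Longrightarrow> IP_set G (FP G p)"
  unfolding IP_set_def using FP_subset_carrier by blast

lemma IP_prod_Un:
  assumes "\<And>i. p i \<in> carrier G" "finite \<alpha>" "finite \<beta>" "\<And>a b. a \<in> \<alpha> \<Longrightarrow> b \<in> \<beta> \<Longrightarrow> a < b"
  shows "IP_prod G p (\<alpha> \<union> \<beta>) = IP_prod G p \<alpha> \<otimes> IP_prod G p \<beta>"
  using sorted_list_of_set_Un[OF assms(2-4)] assms(1)
    foldr_mult_append[of "map p (sorted_list_of_set \<alpha>)" "map p (sorted_list_of_set \<beta>)"]
  unfolding IP_prod_def by (auto simp del: foldr_append)

lemma IP_prod_singleton: "p i \<in> carrier G \<Longrightarrow> IP_prod G p {i} = p i"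
  unfolding IP_prod_def by simp

lemma IP_prod_insert:
  assumes "\<And>i. p i \<in> carrier G" "finite \<beta>" "\<And>b. b \<in> \<beta> \<Longrightarrow> b < n"
  shows "IP_prod G p (insert n \<beta>) = IP_prod G p \<beta> \<otimes> p n"
  using IP_prod_Un[of p \<beta> "{n}"] IP_prod_singleton assms by simp

text \<open>Consecutive blocks concatenate in increasing order of their indices, so the products
  agree although the group may be noncommutative.\<close>

lemma IP_prod_blocks:
  assumes p: "\<And>i. p i \<in> carrier G"
    and fin: "\<And>n. finite (A n)"
    and less: "\<And>i j a b. i < j \<Longrightarrow> a \<in> A i \<Longrightarrow> b \<in> A j \<Longrightarrow> a < b"
    and "finite \<beta>"
  shows "IP_prod G (\<lambda>n. IP_prod G p (A n)) \<beta> = IP_prod G p (\<Union>n\<in>\<beta>. A n)"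
  using \<open>finite \<beta>\<close>
proof (induction \<beta> rule: finite_linorder_max_induct)
  case (insert b \<beta>)
  have "IP_prod G (\<lambda>n. IP_prod G p (A n)) (insert b \<beta>) =
      IP_prod G p (\<Union>n\<in>\<beta>. A n) \<otimes> IP_prod G p (A b)"
    using insert IP_prod_insert[of "\<lambda>n. IP_prod G p (A n)" \<beta> b] IP_prod_closed[OF p] by auto
  also have "\<dots> = IP_prod G p ((\<Union>n\<in>\<beta>. A n) \<union> A b)"
    using insert fin less by (intro IP_prod_Un[symmetric] p) auto
  finally show ?case
    by (simp add: Un_commute)
qed simp

lemma FP_blocks_subset:
  assumes p: "\<And>i. p i \<in> carrier G"
    and fin: "\<And>n. finite (A n)" and ne: "\<And>n. A n \<noteq> {}"
    and less: "\<And>i j a b. i < j \<Longrightarrow> a \<in> A i \<Longrightarrow> b \<in> A j \<Longrightarrow> a < b"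
  shows "FP G (\<lambda>n. IP_prod G p (A n)) \<subseteq> FP G p"
proof
  fix g assume "g \<in> FP G (\<lambda>n. IP_prod G p (A n))"
  then obtain \<beta> where \<beta>: "finite \<beta>" "\<beta> \<noteq> {}" "g = IP_prod G (\<lambda>n. IP_prod G p (A n)) \<beta>"
    unfolding FP_eq by auto
  then have "g = IP_prod G p (\<Union>n\<in>\<beta>. A n)"
    using IP_prod_blocks[OF p fin less] by simp
  moreover have "finite (\<Union>n\<in>\<beta>. A n)" "(\<Union>n\<in>\<beta>. A n) \<noteq> {}"
    using \<beta> fin ne by auto
  ultimately show "g \<in> FP G p"
    unfolding FP_eq by blast
qed

text \<open>The shifted sequence generates an IP-set of its own. This allows a new block to be
  chosen beyond all indices used so far.\<close>

lemma IP_star_set_meets_tail: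
  assumes S: "IP_star_set G S" and p: "\<And>i. p i \<in> carrier G"
  shows "\<exists>\<alpha>. finite \<alpha> \<and> \<alpha> \<noteq> {} \<and> \<alpha> \<subseteq> {n..} \<and> IP_prod G p \<alpha> \<in> S"
proof -
  \<comment> \<open>The shift is written with singleton blocks so that \<open>IP_prod_blocks\<close>
    applies to it.\<close>
  let ?q = "\<lambda>i. IP_prod G p {i + n}"
  have "IP_set G (FP G ?q)"
    by (intro IP_set_FP IP_prod_closed p)
  then obtain \<beta> where \<beta>: "finite \<beta>" "\<beta> \<noteq> {}" "IP_prod G ?q \<beta> \<in> S"
    using S unfolding IP_star_set_def FP_eq by blast
  have "IP_prod G ?q \<beta> = IP_prod G p (\<Union>i\<in>\<beta>. {i + n})"
    by (rule IP_prod_blocks) (use p \<beta> in auto)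
  moreover have "finite (\<Union>i\<in>\<beta>. {i + n})" "(\<Union>i\<in>\<beta>. {i + n}) \<noteq> {}" "(\<Union>i\<in>\<beta>. {i + n}) \<subseteq> {n..}"
    using \<beta> by auto
  ultimately show ?thesis
    using \<beta>(3) by metis
qed

end

section \<open>Refining an IP-set along a recurrent family of open sets\<close>

context dynamical_system
begin

sublocale G: group G
  using group_hom group_hom.axioms(1) by blast

lemma action_closed [simp]: "g \<in> carrier G \<Longrightarrow> x \<in> X \<Longrightarrow> \<phi> g x \<in> X"
  using element_image by blast

lemma action_one [simp]: "x \<in> X \<Longrightarrow> \<phi> \<one> x = x"
  by (metis id_eq_one restrict_apply')

lemma action_PiE: "g \<in> carrier G \<Longrightarrow> \<phi> g \<in> X \<rightarrow>\<^sub>E X"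
  using bij_prop0 unfolding Bij_def by (auto simp: PiE_iff)

lemma action_mult: "g \<in> carrier G \<Longrightarrow> h \<in> carrier G \<Longrightarrow> \<phi> (g \<otimes> h) = compose X (\<phi> g) (\<phi> h)"
  using action_PiE[of "g \<otimes> h"]
  by (intro extensionalityI[of _ X]) (auto simp: compose_eq composition_rule PiE_iff)

lemma openin_action_preimage:
  "g \<in> carrier G \<Longrightarrow> openin mtopology U \<Longrightarrow> openin mtopology {x \<in> X. \<phi> g x \<in> U}"
  using openin_continuous_map_preimage[OF continuous_action] by simp

text \<open>Continuity of \<open>\<phi> g\<close> makes the set of points of \<open>U\<close> sent
  into \<open>U\<close> open; a small closed ball around \<open>y\<close> fits inside. The closure
  condition later keeps limit points inside the nested open sets.\<close>

lemma shrink_open_along_action: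
  assumes "g \<in> carrier G" "openin mtopology U" "y \<in> U" "\<phi> g y \<in> U"
  shows "\<exists>V. openin mtopology V \<and> y \<in> V \<and> mtopology closure_of V \<subseteq> U \<and> \<phi> g ` V \<subseteq> U"
proof -
  have "y \<in> X"
    using assms(2,3) openin_subset by fastforce
  have "openin mtopology (U \<inter> {x \<in> X. \<phi> g x \<in> U})"
    using assms openin_action_preimage by blast
  then obtain r where r: "r > 0" "mcball y r \<subseteq> U \<inter> {x \<in> X. \<phi> g x \<in> U}"
    unfolding openin_mtopology_mcball using assms \<open>y \<in> X\<close> by blast
  have "mtopology closure_of (mball y r) \<subseteq> mcball y r"
    by (intro closure_of_minimal) auto
  moreover have "mball y r \<subseteq> mcball y r"
    by auto
  ultimately show ?thesis
    using r \<open>y \<in> X\<close> by (intro exI[of _ "mball y r"]) auto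
qed

text \<open>Since \<open>p i\<^sub>1 \<otimes> \<dots> \<otimes> p i\<^sub>k\<close> acts by applying its last factor first, nested sets
  with \<open>h n U\<^bsub>n+1\<^esub> \<subseteq> U\<^bsub>n\<^esub>\<close> are pushed towards \<open>U\<^bsub>0\<^esub>\<close> by every finite product.\<close>

lemma IP_prod_nested:
  assumes h: "\<And>n. h n \<in> carrier G"
    and sub: "\<And>n. U n \<subseteq> X" and dec: "\<And>n. U (Suc n) \<subseteq> U n"
    and step: "\<And>n. \<phi> (h n) ` U (Suc n) \<subseteq> U n"
    and w: "\<And>n. w \<in> U n" and "finite \<beta>"
  shows "\<phi> (IP_prod G h \<beta>) w \<in> U 0"
proof -
  have anti: "U n \<subseteq> U m" if "m \<le> n" for m n
    using lift_Suc_antimono_le[of U, OF dec that] .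
  \<comment> \<open>In the induction the largest index \<open>b\<close> acts first and carries
    \<open>U (Suc b)\<close> into \<open>U b\<close>; the remaining indices are below
    \<open>b\<close>, so the hypothesis is applied at level \<open>b\<close>.\<close>
  have "\<phi> (IP_prod G h \<beta>) ` U n \<subseteq> U 0" if "finite \<beta>" "\<And>b. b \<in> \<beta> \<Longrightarrow> b < n" for n
    using that
  proof (induction \<beta> arbitrary: n rule: finite_linorder_max_induct)
    case empty
    then show ?case
      using anti[of 0 n] sub[of n] by (auto simp: subset_iff)
  next
    case (insert b \<beta>)
    have "\<phi> (IP_prod G h (insert b \<beta>)) x \<in> U 0" if "x \<in> U n" for x
    proof -
      have "x \<in> U (Suc b)"
        using anti[OF Suc_leI, of b n] insert.prems that by auto
      then have "\<phi> (h b) x \<in> U b"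
        using step by blast
      then have "\<phi> (IP_prod G h \<beta>) (\<phi> (h b) x) \<in> U 0"
        using insert.IH[of b] insert.hyps by blast
      moreover have "IP_prod G h (insert b \<beta>) = IP_prod G h \<beta> \<otimes> h b"
        using insert.hyps h by (intro G.IP_prod_insert) auto
      ultimately show ?thesis
        using composition_rule[of x "IP_prod G h \<beta>" "h b"] h G.IP_prod_closed[of h, OF h]
          that sub by (metis subsetD)
    qed
    then show ?case by auto
  qed
  moreover obtain n where "\<And>b. b \<in> \<beta> \<Longrightarrow> b < n"
    using \<open>finite \<beta>\<close> finite_nat_set_iff_bounded by auto
  ultimately show ?thesis
    using w \<open>finite \<beta>\<close> by blast
qed

text \<open>Blocks of \<open>p\<close> are chosen one after another, each a return element for the
  current open set. The predicate \<open>P\<close> is left abstract to serve both nonempty open sets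
  and neighbourhoods of a fixed point.\<close>

lemma IP_refinement:
  assumes p: "\<And>i. p i \<in> carrier G"
    and ret: "\<And>U. P U \<Longrightarrow> IP_star_set G
      {g \<in> carrier G. \<exists>V. P V \<and> mtopology closure_of V \<subseteq> U \<and> \<phi> g ` V \<subseteq> U}"
    and "P U"
  obtains h V where "\<And>n. h n \<in> carrier G" "FP G h \<subseteq> FP G p"
    "V 0 = U" "\<And>n. P (V n)" "\<And>n. mtopology closure_of V (Suc n) \<subseteq> V n"
    "\<And>n. \<phi> (h n) ` V (Suc n) \<subseteq> V n"
proof -
  \<comment> \<open>A state is a block with the current open set. The block at stage 0 is arbitrary
    and will be discarded; only the set \<open>U\<close> is prescribed there.\<close>
  define Q where "Q = (\<lambda>(n::nat) (\<alpha> :: nat set, V). finite \<alpha> \<and> \<alpha> \<noteq> {} \<and> P V \<and> (n = 0 \<longrightarrow> V = U))"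
  define R where "R = (\<lambda>(n::nat) (\<alpha> :: nat set, V) (\<alpha>', V').
    (\<forall>a\<in>\<alpha>. \<forall>b\<in>\<alpha>'. a < b) \<and> mtopology closure_of V' \<subseteq> V \<and> \<phi> (IP_prod G p \<alpha>') ` V' \<subseteq> V)"
  have "\<exists>f. \<forall>n. Q n (f n) \<and> R n (f n) (f (Suc n))"
  proof (rule dependent_nat_choice)
    show "\<exists>x. Q 0 x"
      unfolding Q_def using \<open>P U\<close> by auto
    fix x n assume "Q n x"
    then obtain \<alpha> V where x: "x = (\<alpha>, V)" "finite \<alpha>" "\<alpha> \<noteq> {}" "P V"
      unfolding Q_def by auto
    obtain \<beta> V' where \<beta>: "finite \<beta>" "\<beta> \<noteq> {}" "\<beta> \<subseteq> {Suc (Max \<alpha>)..}"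
      and "P V'" "mtopology closure_of V' \<subseteq> V" "\<phi> (IP_prod G p \<beta>) ` V' \<subseteq> V"
      using G.IP_star_set_meets_tail[where p = p and n = "Suc (Max \<alpha>)", OF ret[OF \<open>P V\<close>] p]
      by blast
    moreover have "\<forall>a\<in>\<alpha>. \<forall>b\<in>\<beta>. a < b"
      using less_above_Max[OF x(2) \<beta>(3)] by blast
    ultimately show "\<exists>y. Q (Suc n) y \<and> R n x y"
      unfolding Q_def R_def x(1) using \<beta> by auto
  qed
  then obtain f where Q: "\<And>n. Q n (f n)" and R: "\<And>n. R n (f n) (f (Suc n))"
    by blast
  define A where "A n = fst (f n)" for n
  define V where "V n = snd (f n)" for n
  have A: "finite (A n)" "A n \<noteq> {}" and PV: "P (V n)" and V0: "V 0 = U" for n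
    using Q[of n] Q[of 0] unfolding Q_def A_def V_def by (auto split: prod.splits)
  have step: "\<forall>a\<in>A n. \<forall>b\<in>A (Suc n). a < b" "mtopology closure_of V (Suc n) \<subseteq> V n"
    "\<phi> (IP_prod G p (A (Suc n))) ` V (Suc n) \<subseteq> V n" for n
    using R[of n] unfolding R_def A_def V_def by (auto split: prod.splits)
  \<comment> \<open>Only successive blocks are ordered by construction; transitivity passes through
    an element of the nonempty block in between.\<close>
  have less: "\<forall>a\<in>A i. \<forall>b\<in>A j. a < b" if "i < j" for i j
    using that
  proof (induction rule: strict_inc_induct)
    case (base i)
    then show ?case using step(1) by auto
  next
    case (step i)
    obtain c where "c \<in> A (Suc i)" using A by blast
    with step.IH \<open>\<And>n. \<forall>a\<in>A n. \<forall>b\<in>A (Suc n). a < b\<close> show ?case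
      by (meson order_less_trans)
  qed
  \<comment> \<open>The block chosen together with \<open>V (Suc n)\<close> is the one that moves it
    into \<open>V n\<close>, hence the shift by one.\<close>
  let ?h = "\<lambda>n. IP_prod G p (A (Suc n))"
  have "FP G ?h \<subseteq> FP G p"
  proof (rule G.FP_blocks_subset)
    show "a < b" if "i < j" "a \<in> A (Suc i)" "b \<in> A (Suc j)" for i j a b
      using less[of "Suc i" "Suc j"] that by blast
  qed (use p A in auto)
  moreover have "?h n \<in> carrier G" for n
    by (intro G.IP_prod_closed p)
  ultimately show ?thesis
    using that[of ?h V, OF _ _ V0 PV step(2,3)] by blast
qed

text \<open>In contrast to the definition of centrality, the returning point \<open>w\<close> does not depend on
  the group element.\<close>

lemma central_IP_refinement:
  assumes central: IP_star_central and p: "\<And>i. p i \<in> carrier G"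
    and U: "openin mtopology U" "U \<noteq> {}"
  obtains h w where "\<And>n. h n \<in> carrier G" "FP G h \<subseteq> FP G p" "w \<in> U"
    "\<And>g. g \<in> FP G h \<Longrightarrow> \<phi> g w \<in> U"
proof -
  let ?P = "\<lambda>U. openin mtopology U \<and> U \<noteq> {}"
  have ret: "IP_star_set G {g \<in> carrier G. \<exists>V. ?P V \<and> mtopology closure_of V \<subseteq> U \<and> \<phi> g ` V \<subseteq> U}"
    if U': "?P U" for U
  proof -
    have "IP_star_set G (return_set U U)"
      using central U' unfolding IP_star_central_def by blast
    then show ?thesis
    proof (rule IP_star_set_mono)
      show "return_set U U \<subseteq>
        {g \<in> carrier G. \<exists>V. ?P V \<and> mtopology closure_of V \<subseteq> U \<and> \<phi> g ` V \<subseteq> U}"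
      proof
        fix g assume "g \<in> return_set U U"
        then obtain y where g: "g \<in> carrier G" and y: "y \<in> U" "\<phi> g y \<in> U"
          unfolding return_set_def by auto
        obtain V where V: "openin mtopology V" "y \<in> V" "mtopology closure_of V \<subseteq> U" "\<phi> g ` V \<subseteq> U"
          using shrink_open_along_action[OF g _ y] U' by auto
        then have "?P V" by auto
        then show "g \<in> {g \<in> carrier G. \<exists>V. ?P V \<and> mtopology closure_of V \<subseteq> U \<and> \<phi> g ` V \<subseteq> U}"
          using g V by auto
      qed
    qed auto
  qed
  have PU: "?P U"
    using U by blast
  obtain h V where h: "\<And>n. h n \<in> carrier G" "FP G h \<subseteq> FP G p"
    and V: "V 0 = U" "\<And>n. ?P (V n)" "\<And>n. mtopology closure_of V (Suc n) \<subseteq> V n"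
    "\<And>n. \<phi> (h n) ` V (Suc n) \<subseteq> V n"
    by (rule IP_refinement[of p ?P U, OF p ret PU, rotated]) (rule that)
  have sub: "V n \<subseteq> X" for n
    using V(2)[of n] openin_subset by fastforce
  have in_cl: "V n \<subseteq> mtopology closure_of V n" for n
    using sub by (intro closure_of_subset) simp
  have dec: "V (Suc n) \<subseteq> V n" for n
    using in_cl V(3) by blast
  \<comment> \<open>Compactness gives a point in all the closures, and since each closure lies in
    the preceding open set, this point lies in every \<open>V n\<close>.\<close>
  have "(\<Inter>n. mtopology closure_of V n) \<noteq> {}"
  proof (rule compact_space_imp_nest[OF compact])
    show "mtopology closure_of V n \<noteq> {}" for n
      using in_cl[of n] V(2)[of n] by blast
    show "decseq (\<lambda>n. mtopology closure_of V n)"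
      unfolding decseq_Suc_iff using dec by (auto intro: closure_of_mono[THEN subsetD])
  qed auto
  then obtain w where "\<And>n. w \<in> mtopology closure_of V n"
    by blast
  then have w: "w \<in> V n" for n
    using V(3) by blast
  have "\<phi> g w \<in> U" if "g \<in> FP G h" for g
    using that IP_prod_nested[of h V w, OF h(1) sub dec V(4) w] V(1) unfolding FP_eq by auto
  then show ?thesis
    using that h w[of 0] V(1) by blast
qed

text \<open>Here the nested sets are neighbourhoods of \<open>x\<close>, so \<open>x\<close> itself
  is their common point. Recurrence along a whole IP-set, rather than at one element of it, can then
  be intersected with a further IP*-condition.\<close>

lemma recurrent_IP_refinement:
  assumes rec: "\<And>U. openin mtopology U \<Longrightarrow> x \<in> U \<Longrightarrow> IP_star_set G {g \<in> carrier G. \<phi> g x \<in> U}"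
    and p: "\<And>i. p i \<in> carrier G" and U: "openin mtopology U" "x \<in> U"
  obtains h where "\<And>n. h n \<in> carrier G" "FP G h \<subseteq> FP G p" "\<And>g. g \<in> FP G h \<Longrightarrow> \<phi> g x \<in> U"
proof -
  let ?P = "\<lambda>U. openin mtopology U \<and> x \<in> U"
  have ret: "IP_star_set G {g \<in> carrier G. \<exists>V. ?P V \<and> mtopology closure_of V \<subseteq> U \<and> \<phi> g ` V \<subseteq> U}"
    if "?P U" for U
  proof -
    have "IP_star_set G {g \<in> carrier G. \<phi> g x \<in> U}"
      using rec that by blast
    then show ?thesis
    proof (rule IP_star_set_mono)
      show "{g \<in> carrier G. \<phi> g x \<in> U} \<subseteq>
        {g \<in> carrier G. \<exists>V. ?P V \<and> mtopology closure_of V \<subseteq> U \<and> \<phi> g ` V \<subseteq> U}"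
        using shrink_open_along_action[of _ U x] that by auto
    qed auto
  qed
  have PU: "?P U"
    using U by blast
  obtain h V where h: "\<And>n. h n \<in> carrier G" "FP G h \<subseteq> FP G p"
    and V: "V 0 = U" "\<And>n. ?P (V n)" "\<And>n. mtopology closure_of V (Suc n) \<subseteq> V n"
    "\<And>n. \<phi> (h n) ` V (Suc n) \<subseteq> V n"
    by (rule IP_refinement[of p ?P U, OF p ret PU, rotated]) (rule that)
  have sub: "V n \<subseteq> X" for n
    using V(2)[of n] openin_subset by fastforce
  have dec: "V (Suc n) \<subseteq> V n" for n
    using sub V(3)[of n] closure_of_subset[of "V (Suc n)" mtopology] by fastforce
  have "\<phi> g x \<in> U" if "g \<in> FP G h" for g
    using that IP_prod_nested[of h V x, OF h(1) sub dec V(4)] V(1,2) unfolding FP_eq by auto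
  then show ?thesis
    using that h by blast
qed

section \<open>Pairwise equicontinuity implies distality\<close>

lemma pairwise_equicontinuous_imp_recurrent:
  assumes central: IP_star_central and equi: "pairwise_IP_star_equicontinuous_at x"
    and U: "openin mtopology U" "x \<in> U"
  shows "IP_star_set G {g \<in> carrier G. \<phi> g x \<in> U}"
  unfolding IP_star_set_def
proof (intro conjI allI impI)
  fix E assume "IP_set G E"
  then obtain p where p: "\<And>i. p i \<in> carrier G" "FP G p \<subseteq> E"
    unfolding IP_set_def by blast
  have xX: "x \<in> X"
    using U openin_subset by fastforce
  obtain r where r: "r > 0" "mball x r \<subseteq> U"
    using U unfolding openin_mtopology by blast
  have "r / 2 > 0"
    using r by simp
  from equi[unfolded pairwise_IP_star_equicontinuous_at_def, rule_format, OF this]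
  obtain V where V: "openin mtopology V" "x \<in> V"
    and eq: "\<And>y z. y \<in> V \<Longrightarrow> z \<in> V \<Longrightarrow> IP_star_set G {g \<in> carrier G. d (\<phi> g y) (\<phi> g z) < r / 2}"
    by blast
  \<comment> \<open>\<open>V\<close> permits the comparison of \<open>x\<close> with
    \<open>w\<close>, and the ball keeps \<open>g w\<close> within r/2 of \<open>x\<close>; the two
    halves add up to \<open>r\<close>.\<close>
  let ?W = "V \<inter> mball x (r / 2)"
  have W: "openin mtopology ?W" "x \<in> ?W"
    using V xX r by auto
  obtain h w where h: "\<And>n. h n \<in> carrier G" "FP G h \<subseteq> FP G p" and w: "w \<in> ?W"
    and hw: "\<And>g. g \<in> FP G h \<Longrightarrow> \<phi> g w \<in> ?W"
    by (rule central_IP_refinement[where p = p, OF central p(1) W(1)]) (use W(2) that in blast)+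
  have "IP_set G (FP G h)"
    using G.IP_set_FP h by blast
  then obtain g where g: "g \<in> FP G h" "g \<in> carrier G" "d (\<phi> g x) (\<phi> g w) < r / 2"
    using eq[of x w] V w unfolding IP_star_set_def by blast
  have "\<phi> g w \<in> X" "d x (\<phi> g w) < r / 2"
    using hw[OF g(1)] by auto
  then have "d x (\<phi> g x) < r"
    using triangle[of x "\<phi> g w" "\<phi> g x"] g xX commute[of "\<phi> g x" "\<phi> g w"] by simp
  then have "\<phi> g x \<in> U"
    using r(2) g xX by auto
  then show "{g \<in> carrier G. \<phi> g x \<in> U} \<inter> E \<noteq> {}"
    using g h(2) p(2) by blast
qed auto

lemma action_uniformly_continuous:
  assumes "g \<in> carrier G" "\<epsilon> > 0"
  shows "\<exists>\<delta>>0. \<forall>x\<in>X. \<forall>y\<in>X. d x y < \<delta> \<longrightarrow> d (\<phi> g x) (\<phi> g y) < \<epsilon>"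
proof -
  have "uniformly_continuous_map (metric (X, d)) (metric (X, d)) (\<phi> g)"
    by (rule continuous_imp_uniformly_continuous_map)
      (simp add: continuous_action[OF assms(1)] compact)
  then show ?thesis
    using assms(2) unfolding uniformly_continuous_map_def by (simp add: commute)
qed

text \<open>The sequence is chosen greedily: the next term brings \<open>x\<close> and
  \<open>y\<close> so close together that each of the finitely many earlier products, applied
  afterwards, keeps them within \<epsilon>.\<close>

lemma proximal_IP_set:
  assumes xy: "x \<in> X" "y \<in> X" and prox: "\<And>\<delta>. \<delta> > 0 \<Longrightarrow> \<exists>g\<in>carrier G. d (\<phi> g x) (\<phi> g y) < \<delta>"
    and "\<epsilon> > 0"
  obtains p where "\<And>i. p i \<in> carrier G" "\<And>g. g \<in> FP G p \<Longrightarrow> d (\<phi> g x) (\<phi> g y) < \<epsilon>"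
proof -
  have ex: "\<exists>q\<in>carrier G. \<forall>k\<in>K. d (\<phi> (k \<otimes> q) x) (\<phi> (k \<otimes> q) y) < \<epsilon>"
    if K: "finite K" "K \<subseteq> carrier G" for K
  proof -
    \<comment> \<open>One modulus of uniform continuity serves the whole finite set
      \<open>K\<close>.\<close>
    have "\<exists>\<delta>>0. \<forall>k\<in>K. \<forall>a\<in>X. \<forall>b\<in>X. d a b < \<delta> \<longrightarrow> d (\<phi> k a) (\<phi> k b) < \<epsilon>"
      using K
    proof (induction K rule: finite_induct)
      case empty
      then show ?case by (auto intro: exI[of _ 1])
    next
      case (insert k K)
      then obtain \<delta> \<delta>' where "\<delta> > 0" "\<forall>k\<in>K. \<forall>a\<in>X. \<forall>b\<in>X. d a b < \<delta> \<longrightarrow> d (\<phi> k a) (\<phi> k b) < \<epsilon>"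
        "\<delta>' > 0" "\<forall>a\<in>X. \<forall>b\<in>X. d a b < \<delta>' \<longrightarrow> d (\<phi> k a) (\<phi> k b) < \<epsilon>"
        using action_uniformly_continuous[OF _ \<open>\<epsilon> > 0\<close>, of k] by auto
      then show ?case
        by (intro exI[of _ "min \<delta> \<delta>'"]) auto
    qed
    then obtain \<delta> where "\<delta> > 0"
      and \<delta>: "\<And>k a b. k \<in> K \<Longrightarrow> a \<in> X \<Longrightarrow> b \<in> X \<Longrightarrow> d a b < \<delta> \<Longrightarrow> d (\<phi> k a) (\<phi> k b) < \<epsilon>"
      by blast
    obtain q where q: "q \<in> carrier G" "d (\<phi> q x) (\<phi> q y) < \<delta>"
      using prox \<open>\<delta> > 0\<close> by blast
    have "d (\<phi> (k \<otimes> q) x) (\<phi> (k \<otimes> q) y) < \<epsilon>" if "k \<in> K" for k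
      using \<delta>[OF that, of "\<phi> q x" "\<phi> q y"] q xy K that
      by (auto simp: composition_rule)
    then show ?thesis
      using q by blast
  qed
  \<comment> \<open>\<open>K\<close> holds the products of all earlier terms, the empty one
    included, and \<open>q\<close> is the next term. In \<open>R\<close> the term \<open>q\<close>
    is multiplied on the right because later indices come last in a product.\<close>
  define Q where "Q = (\<lambda>(n::nat) (K, q). finite K \<and> K \<subseteq> carrier G \<and> \<one> \<in> K \<and> q \<in> carrier G \<and>
    (\<forall>k\<in>K. d (\<phi> (k \<otimes> q) x) (\<phi> (k \<otimes> q) y) < \<epsilon>))"
  define R where "R = (\<lambda>(n::nat) (K, q) (K' :: 'g set, q' :: 'g). K' = K \<union> (\<lambda>k. k \<otimes> q) ` K)"
  have "\<exists>f. \<forall>n. Q n (f n) \<and> R n (f n) (f (Suc n))"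
  proof (rule dependent_nat_choice)
    obtain q where "q \<in> carrier G" "\<forall>k\<in>{\<one>}. d (\<phi> (k \<otimes> q) x) (\<phi> (k \<otimes> q) y) < \<epsilon>"
      using ex[of "{\<one>}"] by blast
    then have "Q 0 ({\<one>}, q)"
      unfolding Q_def by simp
    then show "\<exists>s. Q 0 s" ..
    fix s n assume "Q n s"
    then obtain K q where s: "s = (K, q)" "finite K" "K \<subseteq> carrier G" "\<one> \<in> K" "q \<in> carrier G"
      unfolding Q_def by auto
    let ?K = "K \<union> (\<lambda>k. k \<otimes> q) ` K"
    have "finite ?K" "?K \<subseteq> carrier G" "\<one> \<in> ?K"
      using s by auto
    moreover from ex[OF this(1,2)] obtain q' where "q' \<in> carrier G"
      "\<forall>k\<in>?K. d (\<phi> (k \<otimes> q') x) (\<phi> (k \<otimes> q') y) < \<epsilon>" by blast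
    ultimately have "Q (Suc n) (?K, q') \<and> R n s (?K, q')"
      unfolding Q_def R_def s(1) by simp
    then show "\<exists>t. Q (Suc n) t \<and> R n s t" by blast
  qed
  then obtain f where Q: "\<And>n. Q n (f n)" and R: "\<And>n. R n (f n) (f (Suc n))"
    by blast
  define K where "K n = fst (f n)" for n
  define q where "q n = snd (f n)" for n
  have K: "\<one> \<in> K n" and q: "q n \<in> carrier G"
    and close: "\<And>k. k \<in> K n \<Longrightarrow> d (\<phi> (k \<otimes> q n) x) (\<phi> (k \<otimes> q n) y) < \<epsilon>" for n
    using Q[of n] unfolding Q_def K_def q_def by (auto split: prod.splits)
  have KS: "K (Suc n) = K n \<union> (\<lambda>k. k \<otimes> q n) ` K n" for n
    using R[of n] unfolding R_def K_def q_def by (auto split: prod.splits)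
  have mono: "K m \<subseteq> K n" if "m \<le> n" for m n
    using lift_Suc_mono_le[of K, OF _ that] KS by blast
  have in_K: "IP_prod G q \<beta> \<in> K n" if "finite \<beta>" "\<And>b. b \<in> \<beta> \<Longrightarrow> b < n" for \<beta> n
    using that
  proof (induction \<beta> arbitrary: n rule: finite_linorder_max_induct)
    case empty
    then show ?case using K by simp
  next
    case (insert b \<beta>)
    have "IP_prod G q (insert b \<beta>) = IP_prod G q \<beta> \<otimes> q b"
      using insert.hyps q by (intro G.IP_prod_insert) auto
    also have "\<dots> \<in> K (Suc b)"
      using insert.IH[of b] insert.hyps KS by auto
    also have "\<dots> \<subseteq> K n"
      using insert.prems by (intro mono Suc_leI) auto
    finally show ?case .
  qed
  have "d (\<phi> g x) (\<phi> g y) < \<epsilon>" if g: "g \<in> FP G q" for g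
  proof -
    obtain \<beta> where \<beta>: "finite \<beta>" "\<beta> \<noteq> {}" "g = IP_prod G q \<beta>"
      using g unfolding FP_eq by auto
    \<comment> \<open>The last factor is split off: the others have indices below
      \<open>Max \<beta>\<close>, so their product lies in \<open>K (Max \<beta>)\<close>, which
      \<open>close\<close> pairs with \<open>q (Max \<beta>)\<close>.\<close>
    let ?\<gamma> = "\<beta> - {Max \<beta>}"
    have less: "b < Max \<beta>" if "b \<in> ?\<gamma>" for b
      using that \<beta> Max_ge[of \<beta> b] by (simp add: le_neq_implies_less)
    have "insert (Max \<beta>) ?\<gamma> = \<beta>"
      using \<beta> Max_in by blast
    then have "g = IP_prod G q ?\<gamma> \<otimes> q (Max \<beta>)"
      using \<beta> q less G.IP_prod_insert[of q ?\<gamma> "Max \<beta>"] by simp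
    then show ?thesis
      using close in_K[of ?\<gamma> "Max \<beta>"] \<beta> less by simp
  qed
  then show ?thesis
    using that q by blast
qed

lemma recurrent_imp_distal:
  assumes rec: "\<And>x U. openin mtopology U \<Longrightarrow> x \<in> U \<Longrightarrow> IP_star_set G {g \<in> carrier G. \<phi> g x \<in> U}"
  shows distal
  unfolding distal_def
proof (intro ballI impI)
  fix x y assume xy: "x \<in> X" "y \<in> X" "x \<noteq> y"
  show "0 < (INF g\<in>carrier G. d (\<phi> g x) (\<phi> g y))"
  proof (rule ccontr)
    assume neg: "\<not> 0 < (INF g\<in>carrier G. d (\<phi> g x) (\<phi> g y))"
    have prox: "\<exists>g\<in>carrier G. d (\<phi> g x) (\<phi> g y) < \<delta>" if "\<delta> > 0" for \<delta>
    proof (rule ccontr)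
      assume "\<not> ?thesis"
      then have "\<delta> \<le> (INF g\<in>carrier G. d (\<phi> g x) (\<phi> g y))"
        by (intro cINF_greatest) auto
      then show False
        using neg that by simp
    qed
    \<comment> \<open>One third, because the path from \<open>x\<close> to \<open>y\<close> through
      \<open>g x\<close> and \<open>g y\<close> has three pieces.\<close>
    define \<epsilon> where "\<epsilon> = d x y / 3"
    have "\<epsilon> > 0"
      unfolding \<epsilon>_def using xy by simp
    obtain p where p: "\<And>i. p i \<in> carrier G" "\<And>g. g \<in> FP G p \<Longrightarrow> d (\<phi> g x) (\<phi> g y) < \<epsilon>"
      using proximal_IP_set[OF xy(1,2) prox \<open>\<epsilon> > 0\<close>] by blast
    have "x \<in> mball x \<epsilon>"
      using xy \<open>\<epsilon> > 0\<close> by simp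
    \<comment> \<open>\<open>x\<close> must return along an entire IP-set, since the recurrence of
      \<open>y\<close> then selects an element of that set which cannot be prescribed.\<close>
    obtain h where h: "\<And>i. h i \<in> carrier G" "FP G h \<subseteq> FP G p"
      "\<And>g. g \<in> FP G h \<Longrightarrow> \<phi> g x \<in> mball x \<epsilon>"
      by (rule recurrent_IP_refinement[where p = p, OF rec p(1) openin_mball \<open>x \<in> mball x \<epsilon>\<close>,
            rotated 2]) (rule that)
    have "IP_star_set G {g \<in> carrier G. \<phi> g y \<in> mball y \<epsilon>}"
      using rec[of "mball y \<epsilon>" y] xy \<open>\<epsilon> > 0\<close> by simp
    then obtain g where g: "g \<in> FP G h" "g \<in> carrier G" "\<phi> g y \<in> mball y \<epsilon>"
      using G.IP_set_FP[of h, OF h(1)] unfolding IP_star_set_def by blast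
    have "d (\<phi> g x) (\<phi> g y) < \<epsilon>" "d x (\<phi> g x) < \<epsilon>" "d y (\<phi> g y) < \<epsilon>"
      using p(2) h(2) h(3)[OF g(1)] g by auto
    moreover have "d x y \<le> d x (\<phi> g x) + d (\<phi> g x) y" "d (\<phi> g x) y \<le> d (\<phi> g x) (\<phi> g y) + d (\<phi> g y) y"
      using xy g by (auto intro: triangle)
    ultimately show False
      unfolding \<epsilon>_def using commute[of y "\<phi> g y"] by linarith
  qed
qed

section \<open>Distality implies pairwise equicontinuity\<close>

text \<open>Its points are the extensional self-maps of \<open>X\<close>, and it is compact by
  Tychonoff's theorem.\<close>

abbreviation pointwise_topology :: "('x \<Rightarrow> 'x) topology"
  where "pointwise_topology \<equiv> product_topology (\<lambda>_. mtopology) X"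

lemma compose_PiE: "f \<in> X \<rightarrow>\<^sub>E X \<Longrightarrow> g \<in> X \<rightarrow>\<^sub>E X \<Longrightarrow> compose X f g \<in> X \<rightarrow>\<^sub>E X"
  by (auto simp: compose_def PiE_iff)

text \<open>For any self-map \<open>g\<close>, evaluating \<open>compose X f g\<close> at
  \<open>x\<close> is evaluating \<open>f\<close> at \<open>g x\<close>, which is a coordinate
  projection.\<close>

lemma continuous_compose_right:
  assumes "g \<in> X \<rightarrow>\<^sub>E X"
  shows "continuous_map pointwise_topology pointwise_topology (\<lambda>f. compose X f g)"
  unfolding continuous_map_componentwise
proof (intro conjI ballI)
  fix x assume "x \<in> X"
  then have "continuous_map pointwise_topology mtopology (\<lambda>f. f (g x))"
    using assms continuous_map_product_projection[of "g x" X "\<lambda>_. mtopology"] by auto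
  then show "continuous_map pointwise_topology mtopology (\<lambda>f. compose X f g x)"
    using \<open>x \<in> X\<close> by (simp add: compose_eq)
qed auto

text \<open>Left composition relies on the continuity of the outer map. A pointwise limit of the
  maps \<open>\<phi> g\<close> may be discontinuous, so this is stated for group elements.\<close>

lemma continuous_compose_action:
  assumes "g \<in> carrier G"
  shows "continuous_map pointwise_topology pointwise_topology (\<lambda>f. compose X (\<phi> g) f)"
  unfolding continuous_map_componentwise
proof (intro conjI ballI)
  fix x assume "x \<in> X"
  then have "continuous_map pointwise_topology mtopology (\<phi> g \<circ> (\<lambda>f. f x))"
    using continuous_map_product_projection[of x X "\<lambda>_. mtopology"] continuous_action[OF assms]
    by (auto intro: continuous_map_compose)
  then show "continuous_map pointwise_topology mtopology (\<lambda>f. compose X (\<phi> g) f x)"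
    using \<open>x \<in> X\<close> by (simp add: compose_eq o_def)
qed auto

text \<open>The limits of \<open>\<phi> (IP_prod G p \<alpha>)\<close> as \<open>min \<alpha>\<close> tends to infinity form a compact semigroup.
  Its idempotents \<open>u\<close> make \<open>x\<close> and \<open>u x\<close> proximal.\<close>

lemma IP_limit_idempotent:
  assumes p: "\<And>i. p i \<in> carrier G"
  obtains u where "u \<in> X \<rightarrow>\<^sub>E X" "compose X u u = u"
    "u \<in> pointwise_topology closure_of (\<phi> ` FP G p)"
proof -
  let ?T = pointwise_topology
  define F where "F n = {\<phi> (IP_prod G p \<alpha>) | \<alpha>. finite \<alpha> \<and> \<alpha> \<noteq> {} \<and> \<alpha> \<subseteq> {n..}}" for n
  \<comment> \<open>The limit maps: \<open>F n\<close> is the tail of products using only indices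
    from \<open>n\<close> on.\<close>
  define S where "S = (\<Inter>n. ?T closure_of F n)"
  have F_I: "\<phi> (IP_prod G p \<alpha>) \<in> F n" if "finite \<alpha>" "\<alpha> \<noteq> {}" "\<alpha> \<subseteq> {n..}" for \<alpha> n
    unfolding F_def using that by blast
  have F_sub: "F n \<subseteq> X \<rightarrow>\<^sub>E X" for n
    unfolding F_def using action_PiE G.IP_prod_closed[of p, OF p] by blast
  have comp: "compact_space ?T"
    unfolding compact_space_product_topology using compact by blast
  have haus: "Hausdorff_space ?T"
    unfolding Hausdorff_space_product_topology using Hausdorff_space_mtopology by blast
  have S_cl: "closedin ?T S"
    unfolding S_def by (intro closedin_INT) auto
  then have S_sub: "S \<subseteq> X \<rightarrow>\<^sub>E X"
    using closedin_subset by fastforce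
  have "S \<noteq> {}"
    unfolding S_def
  proof (rule compact_space_imp_nest[OF comp])
    show "?T closure_of F n \<noteq> {}" for n
    proof -
      have "\<phi> (IP_prod G p {n}) \<in> F n"
        unfolding F_def by blast
      moreover have "F n \<subseteq> ?T closure_of F n"
        using F_sub by (intro closure_of_subset) simp
      ultimately show ?thesis by blast
    qed
    show "decseq (\<lambda>n. ?T closure_of F n)"
      unfolding decseq_Suc_iff
    proof (intro allI closure_of_mono)
      fix n
      show "F (Suc n) \<subseteq> F n"
      proof
        fix f assume "f \<in> F (Suc n)"
        then obtain \<alpha> where \<alpha>: "finite \<alpha>" "\<alpha> \<noteq> {}" "\<alpha> \<subseteq> {Suc n..}" "f = \<phi> (IP_prod G p \<alpha>)"
          unfolding F_def by auto
        have "\<alpha> \<subseteq> {n..}"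
          using \<alpha>(3) by (auto dest!: subsetD)
        then show "f \<in> F n"
          unfolding \<alpha>(4) using \<alpha> by (intro F_I) auto
      qed
    qed
  qed auto
  have S_mult: "compose X f g \<in> S" if f: "f \<in> S" and g: "g \<in> S" for f g
    unfolding S_def
  proof (rule INT_I)
    fix n
    have fg: "f \<in> X \<rightarrow>\<^sub>E X" "g \<in> X \<rightarrow>\<^sub>E X"
      using f g S_sub by auto
    show "compose X f g \<in> ?T closure_of F n"
      unfolding in_closure_of
    proof (intro conjI allI impI)
      show "compose X f g \<in> topspace ?T"
        using fg compose_PiE by simp
      fix W assume W: "compose X f g \<in> W \<and> openin ?T W"
      \<comment> \<open>The factors are approximated in turn. First \<open>f\<close> is replaced by
        a product over some \<alpha> with \<open>g\<close> fixed; then, with \<alpha> fixed,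
        \<open>g\<close> is replaced by a product over indices beyond \<alpha>. The composite is the
        product over the union.\<close>
      have "openin ?T {f \<in> topspace ?T. compose X f g \<in> W}"
        using openin_continuous_map_preimage[OF continuous_compose_right[OF fg(2)]] W by blast
      moreover have "f \<in> {f \<in> topspace ?T. compose X f g \<in> W}"
        using fg W by simp
      moreover have "f \<in> ?T closure_of F n"
        using f unfolding S_def by blast
      ultimately obtain f' where "f' \<in> F n" "compose X f' g \<in> W"
        using closure_of_meets_open[of f ?T "F n" "{f \<in> topspace ?T. compose X f g \<in> W}"] by auto
      then obtain \<alpha> where \<alpha>: "finite \<alpha>" "\<alpha> \<noteq> {}" "\<alpha> \<subseteq> {n..}"
        "compose X (\<phi> (IP_prod G p \<alpha>)) g \<in> W"
        unfolding F_def by auto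
      let ?k = "IP_prod G p \<alpha>"
      have k: "?k \<in> carrier G"
        by (intro G.IP_prod_closed p)
      have "openin ?T {f \<in> topspace ?T. compose X (\<phi> ?k) f \<in> W}"
        using openin_continuous_map_preimage[OF continuous_compose_action[OF k]] W by blast
      moreover have "g \<in> {f \<in> topspace ?T. compose X (\<phi> ?k) f \<in> W}"
        using fg \<alpha> by simp
      moreover have "g \<in> ?T closure_of F (Suc (Max \<alpha>))"
        using g unfolding S_def by blast
      ultimately obtain g' where "g' \<in> F (Suc (Max \<alpha>))" "compose X (\<phi> ?k) g' \<in> W"
        using closure_of_meets_open[of g ?T "F (Suc (Max \<alpha>))" "{f \<in> topspace ?T. compose X (\<phi> ?k) f \<in> W}"]
        by auto
      then obtain \<beta> where \<beta>: "finite \<beta>" "\<beta> \<noteq> {}" "\<beta> \<subseteq> {Suc (Max \<alpha>)..}"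
        "compose X (\<phi> ?k) (\<phi> (IP_prod G p \<beta>)) \<in> W"
        unfolding F_def by auto
      have less: "a < b" if "a \<in> \<alpha>" "b \<in> \<beta>" for a b
        using less_above_Max[OF \<alpha>(1) \<beta>(3)] that by blast
      have "\<phi> (IP_prod G p (\<alpha> \<union> \<beta>)) = compose X (\<phi> ?k) (\<phi> (IP_prod G p \<beta>))"
        using G.IP_prod_Un[of p \<alpha> \<beta>] p \<alpha>(1) \<beta>(1) less action_mult k G.IP_prod_closed[of p, OF p]
        by simp
      moreover have "\<alpha> \<union> \<beta> \<subseteq> {n..}"
      proof -
        have "n \<le> b" if "b \<in> \<beta>" for b
          using that less \<alpha>(2,3) by fastforce
        then show ?thesis using \<alpha>(3) by auto
      qed
      ultimately show "\<exists>y. y \<in> F n \<and> y \<in> W"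
        using \<alpha>(1,2) \<beta>(1,4) F_I[of "\<alpha> \<union> \<beta>" n] by (intro exI[of _ "\<phi> (IP_prod G p (\<alpha> \<union> \<beta>))"]) auto
    qed
  qed
  have top_S: "topspace (subtopology ?T S) = S"
    using S_sub by auto
  have "\<exists>u\<in>topspace (subtopology ?T S). compose X u u = u"
  proof (rule Ellis_Numakura[where m = "compose X"])
    show "compact_space (subtopology ?T S)"
      using closedin_compact_space[OF comp S_cl] compact_space_subtopology by blast
    show "continuous_map (subtopology ?T S) (subtopology ?T S) (\<lambda>f. compose X f g)"
      if "g \<in> topspace (subtopology ?T S)" for g
    proof (rule continuous_map_into_subtopology)
      have g: "g \<in> S"
        using that unfolding top_S .
      then show "continuous_map (subtopology ?T S) ?T (\<lambda>f. compose X f g)"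
        using S_sub by (intro continuous_map_from_subtopology continuous_compose_right) auto
      show "(\<lambda>f. compose X f g) \<in> topspace (subtopology ?T S) \<rightarrow> S"
        unfolding top_S using g S_mult by auto
    qed
    show "compose X (compose X f g) h = compose X f (compose X g h)"
      if "h \<in> topspace (subtopology ?T S)" for f g h
      using compose_assoc[of h X X f g] that S_sub unfolding top_S by (auto simp: PiE_iff)
    show "Hausdorff_space (subtopology ?T S)"
      using haus by (rule Hausdorff_space_subtopology)
  qed (unfold top_S, use S_mult \<open>S \<noteq> {}\<close> in auto)
  then obtain u where u: "u \<in> S" "compose X u u = u"
    unfolding top_S by blast
  moreover have "F 0 \<subseteq> \<phi> ` FP G p"
    unfolding F_def FP_eq by auto
  then have "S \<subseteq> ?T closure_of (\<phi> ` FP G p)"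
    unfolding S_def using closure_of_mono by blast
  ultimately show ?thesis
    using that S_sub by blast
qed

text \<open>Two coordinates are constrained at once by intersecting two subbasic open sets, so a
  single \<open>g\<close> approximates \<open>u\<close> at both points.\<close>

lemma in_pointwise_closure:
  assumes "u \<in> pointwise_topology closure_of (\<phi> ` E)" "y \<in> X" "z \<in> X" "\<epsilon> > 0"
  shows "\<exists>g\<in>E. d (u y) (\<phi> g y) < \<epsilon> \<and> d (u z) (\<phi> g z) < \<epsilon>"
proof -
  let ?T = pointwise_topology
  have u: "u \<in> X \<rightarrow>\<^sub>E X"
    using assms(1) in_closure_of[of u ?T] by simp
  let ?O = "\<lambda>x. {f \<in> topspace ?T. f x \<in> mball (u x) \<epsilon>}"
  have "openin ?T (?O x)" if "x \<in> X" for x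
    by (rule openin_continuous_map_preimage[OF continuous_map_product_projection[OF that] openin_mball])
  moreover have "u \<in> ?O x" if "x \<in> X" for x
    using u that \<open>\<epsilon> > 0\<close> by (auto simp: PiE_iff)
  ultimately have "openin ?T (?O y \<inter> ?O z)" "u \<in> ?O y \<inter> ?O z"
    using assms by auto
  then obtain f where "f \<in> \<phi> ` E" "f \<in> ?O y \<inter> ?O z"
    using closure_of_meets_open[OF assms(1)] by blast
  then show ?thesis by auto
qed

text \<open>The idempotent \<open>u\<close> sends \<open>x\<close> and \<open>u x\<close> to the
  same point, so distality forces \<open>u x = x\<close>. Elements of the IP-set approximating
  \<open>u\<close> then move \<open>y\<close> and \<open>z\<close> only slightly.\<close>

lemma distal_imp_recurrent:
  assumes distal and p: "\<And>i. p i \<in> carrier G" and yz: "y \<in> X" "z \<in> X" and "\<epsilon> > 0"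
  shows "\<exists>g\<in>FP G p. d y (\<phi> g y) < \<epsilon> \<and> d z (\<phi> g z) < \<epsilon>"
proof -
  obtain u where u: "u \<in> X \<rightarrow>\<^sub>E X" "compose X u u = u"
    and cl: "u \<in> pointwise_topology closure_of (\<phi> ` FP G p)"
    using IP_limit_idempotent[of p, OF p] by blast
  have "u x = x" if x: "x \<in> X" for x
  proof (rule ccontr)
    assume neq: "u x \<noteq> x"
    have ux: "u x \<in> X" "u (u x) = u x"
      using u x by (auto simp: PiE_iff) (metis compose_eq)
    let ?c = "INF g\<in>carrier G. d (\<phi> g x) (\<phi> g (u x))"
    have "?c > 0"
      using \<open>distal\<close> x ux neq unfolding distal_def by metis
    \<comment> \<open>Since \<open>u (u x) = u x\<close>, one \<open>g\<close> brings both
      \<open>x\<close> and \<open>u x\<close> within half the infimum of the same point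
      \<open>u x\<close>.\<close>
    then obtain g where g: "g \<in> FP G p" "d (u x) (\<phi> g x) < ?c / 2" "d (u x) (\<phi> g (u x)) < ?c / 2"
      using in_pointwise_closure[OF cl x ux(1), of "?c / 2"] ux(2) by auto
    have gG: "g \<in> carrier G"
      using g G.FP_subset_carrier[of p, OF p] by blast
    have "?c \<le> d (\<phi> g x) (\<phi> g (u x))"
      by (intro cINF_lower gG bdd_belowI[of _ 0]) auto
    also have "\<dots> \<le> d (\<phi> g x) (u x) + d (u x) (\<phi> g (u x))"
      using gG x ux by (intro triangle) auto
    also have "\<dots> < ?c"
      using g commute[of "u x" "\<phi> g x"] by linarith
    finally show False by simp
  qed
  then show ?thesis
    using in_pointwise_closure[OF cl yz \<open>\<epsilon> > 0\<close>] yz by auto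
qed

lemma distal_imp_pairwise_equicontinuous:
  assumes distal
  shows pairwise_IP_star_equicontinuous
  unfolding pairwise_IP_star_equicontinuous_def pairwise_IP_star_equicontinuous_at_def
proof (intro ballI allI impI)
  fix x and \<epsilon> :: real assume x: "x \<in> X" and "\<epsilon> > 0"
  \<comment> \<open>A quarter, for the three intermediate points \<open>y\<close>, \<open>x\<close>,
    \<open>z\<close> between \<open>g y\<close> and \<open>g z\<close>.\<close>
  let ?U = "mball x (\<epsilon> / 4)"
  have "IP_star_set G {g \<in> carrier G. d (\<phi> g y) (\<phi> g z) < \<epsilon>}" if yz: "y \<in> ?U" "z \<in> ?U" for y z
    unfolding IP_star_set_def
  proof (intro conjI allI impI)
    fix E assume "IP_set G E"
    then obtain p where p: "\<And>i. p i \<in> carrier G" "FP G p \<subseteq> E"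
      unfolding IP_set_def by blast
    have X: "y \<in> X" "z \<in> X" and near: "d x y < \<epsilon> / 4" "d x z < \<epsilon> / 4"
      using yz by auto
    obtain g where g: "g \<in> FP G p" "d y (\<phi> g y) < \<epsilon> / 4" "d z (\<phi> g z) < \<epsilon> / 4"
      using distal_imp_recurrent[where p = p and \<epsilon> = "\<epsilon> / 4", OF assms p(1) X] \<open>\<epsilon> > 0\<close> by auto
    have gG: "g \<in> carrier G"
      using g G.FP_subset_carrier[of p, OF p(1)] by blast
    then have gX: "\<phi> g y \<in> X" "\<phi> g z \<in> X"
      using X by auto
    have "d (\<phi> g y) (\<phi> g z) \<le> d (\<phi> g y) y + d y x + d x z + d z (\<phi> g z)"
      using triangle[OF gX(1) X(1) gX(2)] triangle[OF X(1) x gX(2)] triangle[OF x X(2) gX(2)]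
      by linarith
    also have "\<dots> < \<epsilon>"
      using g near commute[of x y] commute[of y "\<phi> g y"] by linarith
    finally show "{g \<in> carrier G. d (\<phi> g y) (\<phi> g z) < \<epsilon>} \<inter> E \<noteq> {}"
      using gG g p(2) by blast
  qed auto
  then show "\<exists>U. openin mtopology U \<and> x \<in> U \<and>
      (\<forall>y\<in>U. \<forall>z\<in>U. IP_star_set G {g \<in> carrier G. d (\<phi> g y) (\<phi> g z) < \<epsilon>})"
    using x \<open>\<epsilon> > 0\<close> by (intro exI[of _ ?U]) auto
qed

lemma central_pairwise_equicontinuous_imp_distal:
  assumes IP_star_central pairwise_IP_star_equicontinuous
  shows distal
proof (rule recurrent_imp_distal)
  fix x U assume U: "openin mtopology U" "x \<in> U"
  then have "x \<in> X"
    using openin_subset by fastforce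
  then show "IP_star_set G {g \<in> carrier G. \<phi> g x \<in> U}"
    using pairwise_equicontinuous_imp_recurrent assms U
    unfolding pairwise_IP_star_equicontinuous_def by blast
qed

end

theorem theorem3p6:
  fixes X :: "'x set" and d :: "'x \<Rightarrow> 'x \<Rightarrow> real"
    and G :: "('g, 'm) monoid_scheme" and \<phi> :: "'g \<Rightarrow> 'x \<Rightarrow> 'x"
  assumes "dynamical_system X d G \<phi>"
    and "dynamical_system.IP_star_central X d G \<phi>"
  shows "dynamical_system.distal X d G \<phi> \<longleftrightarrow>
    dynamical_system.pairwise_IP_star_equicontinuous X d G \<phi>"
proof -
  interpret dynamical_system X d G \<phi>
    by fact
  show ?thesis
    using assms(2) distal_imp_pairwise_equicontinuous central_pairwise_equicontinuous_imp_distal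
    by blast
qed

end
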